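(* Let $v$ be a typical weight and let $X$ be an initial space such that for every $f\in X$ and $0\le r<1$ the function $f_r(z)=f(rz)$ belongs to $X$, and $\sup_{0\le r<1}\|f_r\|_X\le C\|f\|_X$ for a constant $C$ independent of $f$. Let $T$ be an intrinsic operator on $\mathcal{H}(\mathbb{D})$ such that $Tf_r\in\mathcal{B}_{v,0}$ for all $f\in X$ and all $0\le r<1$. If $T:X\to\mathcal{B}_v$ is weakly compact, then $T:X\to\mathcal{B}_{v,0}$ is bounded.
   Context: $\mathcal{H}(\mathbb{D})$ is the space of holomorphic functions on the unit disk $\mathbb{D}$ with the topology $\tau_{uc}$ of uniform convergence on compact subsets. A linear operator $T$ on $\mathcal{H}(\mathbb{D})$ is intrinsic if it maps $\tau_{uc}$-convergent sequences to $\tau_{uc}$-convergent sequences. An initial space is a Banach space $X\subset\mathcal{H}(\mathbb{D})$ containing the polynomials such that every sequence in the closed unit ball of $X$ has a subsequence converging in $\tau_{uc}$ to some function in $X$. A typical weight is a continuous radial $v:\mathbb{D}\to(0,1]$, non-increasing in $|z|$, with $v(z)\to0$ as $|z|\to1$. $\mathcal{B}_v=\{f\in\mathcal{H}(\mathbb{D}):\sup_z v(z)|f'(z)|<\infty\}$ with norm $|f(0)|+\sup_z v(z)|f'(z)|$, and $\mathcal{B}_{v,0}=\{f:\lim_{|z|\to1}v(z)|f'(z)|=0\}$. *)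

theory Defs
  imports "HOL-Complex_Analysis.Complex_Analysis" "HOL-Computational_Algebra.Polynomial"
begin

type_synonym hfun = "complex \<Rightarrow> complex"

text \<open>H(D): functions holomorphic on the unit disc (values outside the disc are irrelevant).\<close>
definition HD :: "hfun set" where
  "HD = {f. f holomorphic_on ball 0 1}"

definition uc_conv :: "(nat \<Rightarrow> hfun) \<Rightarrow> hfun \<Rightarrow> bool" where
  "uc_conv F g \<longleftrightarrow> (\<forall>K. compact K \<and> K \<subseteq> ball 0 1 \<longrightarrow> uniform_limit K F g sequentially)"

definition intrinsic :: "(hfun \<Rightarrow> hfun) \<Rightarrow> bool" where
  "intrinsic T \<longleftrightarrow>
     T ` HD \<subseteq> HD \<and>
     (\<forall>f\<in>HD. \<forall>g\<in>HD. \<forall>a b::complex. \<forall>z\<in>ball 0 1.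
        T (\<lambda>w. a * f w + b * g w) z = a * T f z + b * T g z) \<and>
     (\<forall>F g. (\<forall>n. F n \<in> HD) \<and> g \<in> HD \<and> uc_conv F g \<longrightarrow>
        (\<exists>h\<in>HD. uc_conv (\<lambda>n. T (F n)) h))"

definition banach_fun_space :: "hfun set \<Rightarrow> (hfun \<Rightarrow> real) \<Rightarrow> bool" where
  "banach_fun_space X N \<longleftrightarrow>
     X \<subseteq> HD \<and>
     (\<forall>f\<in>X. \<forall>g\<in>X. \<forall>a b::complex. (\<lambda>z. a * f z + b * g z) \<in> X) \<and>
     (\<forall>f\<in>X. 0 \<le> N f) \<and>
     (\<forall>f\<in>X. N f = 0 \<longrightarrow> (\<forall>z\<in>ball 0 1. f z = 0)) \<and>
     (\<forall>f\<in>X. \<forall>a::complex. N (\<lambda>z. a * f z) = cmod a * N f) \<and>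
     (\<forall>f\<in>X. \<forall>g\<in>X. N (\<lambda>z. f z + g z) \<le> N f + N g) \<and>
     (\<forall>F. (\<forall>n. F n \<in> X) \<and> (\<forall>e>0. \<exists>M. \<forall>m\<ge>M. \<forall>n\<ge>M. N (\<lambda>z. F m z - F n z) < e) \<longrightarrow>
        (\<exists>g\<in>X. (\<lambda>n. N (\<lambda>z. F n z - g z)) \<longlonglongrightarrow> 0))"

definition initial_space :: "hfun set \<Rightarrow> (hfun \<Rightarrow> real) \<Rightarrow> bool" where
  "initial_space X N \<longleftrightarrow>
     banach_fun_space X N \<and>
     (\<forall>p::complex poly. (\<lambda>z. poly p z) \<in> X) \<and>
     (\<forall>F. (\<forall>n. F n \<in> X \<and> N (F n) \<le> 1) \<longrightarrow>
        (\<exists>(\<sigma>::nat \<Rightarrow> nat) g. strict_mono \<sigma> \<and> g \<in> X \<and> uc_conv (F \<circ> \<sigma>) g))"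

definition typical_weight :: "(complex \<Rightarrow> real) \<Rightarrow> bool" where
  "typical_weight v \<longleftrightarrow>
     continuous_on (ball 0 1) v \<and>
     (\<forall>z\<in>ball 0 1. 0 < v z \<and> v z \<le> 1) \<and>
     (\<forall>z\<in>ball 0 1. \<forall>w\<in>ball 0 1. norm z = norm w \<longrightarrow> v z = v w) \<and>
     (\<forall>z\<in>ball 0 1. \<forall>w\<in>ball 0 1. norm z \<le> norm w \<longrightarrow> v w \<le> v z) \<and>
     (\<forall>e>0. \<exists>\<delta><1. \<forall>z. \<delta> < norm z \<and> norm z < 1 \<longrightarrow> v z < e)"

definition Bv :: "(complex \<Rightarrow> real) \<Rightarrow> hfun set" where
  "Bv v = {f\<in>HD. \<exists>M. \<forall>z\<in>ball 0 1. v z * cmod (deriv f z) \<le> M}"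

definition Bv_norm :: "(complex \<Rightarrow> real) \<Rightarrow> hfun \<Rightarrow> real" where
  "Bv_norm v f = cmod (f 0) + (SUP z\<in>ball 0 1. v z * cmod (deriv f z))"

definition Bv0 :: "(complex \<Rightarrow> real) \<Rightarrow> hfun set" where
  "Bv0 v = {f\<in>HD. \<forall>e>0. \<exists>\<delta><1. \<forall>z. \<delta> < norm z \<and> norm z < 1 \<longrightarrow> v z * cmod (deriv f z) < e}"

definition Bv_dual :: "(complex \<Rightarrow> real) \<Rightarrow> (hfun \<Rightarrow> complex) set" where
  "Bv_dual v = {\<phi>.
     (\<forall>f\<in>Bv v. \<forall>g\<in>Bv v. \<forall>a b::complex. \<phi> (\<lambda>z. a * f z + b * g z) = a * \<phi> f + b * \<phi> g) \<and>
     (\<exists>C. \<forall>f\<in>Bv v. cmod (\<phi> f) \<le> C * Bv_norm v f)}"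

definition weak_top :: "(complex \<Rightarrow> real) \<Rightarrow> hfun topology" where
  "weak_top v = pullback_topology (Bv v) (\<lambda>f. restrict (\<lambda>\<phi>. \<phi> f) (Bv_dual v))
                  (product_topology (\<lambda>_. euclidean) (Bv_dual v))"

definition weakly_compact_op :: "(hfun \<Rightarrow> hfun) \<Rightarrow> hfun set \<Rightarrow> (hfun \<Rightarrow> real) \<Rightarrow> (complex \<Rightarrow> real) \<Rightarrow> bool" where
  "weakly_compact_op T X N v \<longleftrightarrow>
     T ` X \<subseteq> Bv v \<and>
     compactin (weak_top v) ((weak_top v) closure_of (T ` {f\<in>X. N f \<le> 1}))"

end

theory Submission
  imports Defs
begin

text \<open>
  Let S be the image under T of the unit ball of X. Being weakly relatively compact, S is
  bounded under every continuous functional on B_v, and a gliding hump argument upgrades this to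
  norm boundedness. It only uses the functionals g \<mapsto> \<Sum>k c_k u_k v(z_k) g'(z_k) with summable c.

  For the inclusion in B_{v,0}, rescale f so that all its dilations f_r lie in the unit ball of X.
  As r \<rightarrow> 1 the functions T f_r \<in> S \<inter> B_{v,0} converge to T f locally uniformly, and weak
  compactness gives a weak cluster point p of them; testing with g \<mapsto> v(z) g'(z) shows p' = (T f)'.
  If p were not in B_{v,0}, an ultrafilter limit of v(z_k) g'(z_k) along points with |z_k| \<rightarrow> 1
  where v |p'| stays large would be a continuous functional vanishing on B_{v,0} but not at p.
\<close>

section \<open>Ultrafilters\<close>

definition ultrafilter :: "'a filter \<Rightarrow> bool" where
  "ultrafilter U \<longleftrightarrow> U \<noteq> bot \<and> (\<forall>P. eventually P U \<or> eventually (\<lambda>x. \<not> P x) U)"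

lemma maximal_filter_ultrafilter:
  assumes "F \<noteq> bot" and max: "\<And>G. G \<noteq> bot \<Longrightarrow> G \<le> F \<Longrightarrow> F = G"
  shows "ultrafilter F"
  unfolding ultrafilter_def
proof (intro conjI allI assms(1) disjCI)
  fix P assume "\<not> (\<forall>\<^sub>F x in F. \<not> P x)"
  then have "inf F (principal {x. P x}) \<noteq> bot"
    by (simp add: trivial_limit_def eventually_inf_principal not_eventually)
  then have F: "F = inf F (principal {x. P x})" by (rule max) simp
  show "eventually P F" by (subst F) (simp add: eventually_inf_principal)
qed

lemma exists_ultrafilter_le:
  fixes F :: "'a filter" assumes F: "F \<noteq> bot"
  shows "\<exists>U\<le>F. ultrafilter U"
proof -
  let ?R = "{(b, a). a \<noteq> bot \<and> a \<le> b \<and> b \<le> F}"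
  have not_bot: "c \<in> Chains ?R \<Longrightarrow> bot \<notin> c" for c by (auto simp: Chains_def)
  have Field_R[simp]: "Field ?R = {G. G \<noteq> bot \<and> G \<le> F}"
    by (auto simp: Field_def bot_unique)
  have "\<exists>m\<in>Field ?R. \<forall>a\<in>Field ?R. (m, a) \<in> ?R \<longrightarrow> a = m"
  proof (rule Zorns_po_lemma)
    show "Partial_order ?R"
      by (auto simp: partial_order_on_def preorder_on_def
          antisym_def refl_on_def trans_def Field_def bot_unique)
    show "\<exists>u\<in>Field ?R. \<forall>a\<in>C. (a, u) \<in> ?R" if C: "C \<in> Chains ?R" for C
    proof (simp, intro exI conjI ballI)
      have Inf_C: "Inf C \<noteq> bot" "Inf C \<le> F" if "C \<noteq> {}"
      proof -
        from C that have "Inf C = bot \<longleftrightarrow> (\<exists>x\<in>C. x = bot)"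
          unfolding trivial_limit_def by (intro eventually_Inf_base) (auto simp: Chains_def)
        with C show "Inf C \<noteq> bot" by (simp add: not_bot)
        from that obtain x where "x \<in> C" by auto
        with C show "Inf C \<le> F" by (auto intro!: Inf_lower2[of x] simp: Chains_def)
      qed
      then have [simp]: "inf F (Inf C) = (if C = {} then F else Inf C)"
        using C by (auto simp add: inf_absorb2)
      from C show "inf F (Inf C) \<noteq> bot" by (simp add: F Inf_C)
      from C show "inf F (Inf C) \<le> F" by (simp add: Chains_def Inf_C F)
      with C show "inf F (Inf C) \<le> x" "x \<le> F" if "x \<in> C" for x
        using that by (auto intro: Inf_lower simp: Chains_def)
    qed
  qed
  then obtain U where U: "U \<in> Field ?R" "\<forall>a\<in>Field ?R. (U, a) \<in> ?R \<longrightarrow> a = U" ..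
  have "ultrafilter U"
  proof (rule maximal_filter_ultrafilter)
    show "U \<noteq> bot" using U(1) by simp
    fix G :: "'a filter" assume "G \<noteq> bot" "G \<le> U"
    moreover have "U \<le> F" using U(1) by simp
    ultimately have "G \<in> Field ?R" "(U, G) \<in> ?R" using order_trans by auto
    then show "U = G" using U(2) by blast
  qed
  then show ?thesis using U(1) by auto
qed

lemma ultrafilter_tendsto_Lim:
  fixes x :: "'b \<Rightarrow> 'a::heine_borel"
  assumes U: "ultrafilter U" and bounded: "bounded (range x)"
  shows "(x \<longlongrightarrow> Lim U x) U"
proof -
  have U_not_bot: "U \<noteq> bot" using U by (simp add: ultrafilter_def)
  have "compact (closure (range x))" using bounded by (simp add: compact_closure)
  moreover have "eventually (\<lambda>y. y \<in> closure (range x)) (filtermap x U)"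
    by (simp add: eventually_filtermap closure_subset[THEN subsetD])
  moreover have "filtermap x U \<noteq> bot" using U_not_bot by (simp add: filtermap_bot_iff)
  ultimately obtain l where l: "inf (nhds l) (filtermap x U) \<noteq> bot"
    unfolding compact_filter by blast
  have "(x \<longlongrightarrow> l) U"
  proof (rule topological_tendstoI)
    fix S assume S: "open S" "l \<in> S"
    show "eventually (\<lambda>k. x k \<in> S) U"
    proof (rule ccontr)
      assume "\<not> ?thesis"
      then have "eventually (\<lambda>k. x k \<notin> S) U" using U unfolding ultrafilter_def by blast
      then have "eventually (\<lambda>y. y \<notin> S) (filtermap x U)" by (simp add: eventually_filtermap)
      moreover have "eventually (\<lambda>y. y \<in> S) (nhds l)" using S eventually_nhds by blast
      ultimately have "eventually (\<lambda>y. False) (inf (nhds l) (filtermap x U))"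
        using eventually_inf by fastforce
      then show False using l by (simp add: trivial_limit_def)
    qed
  qed
  then show ?thesis using tendsto_Lim U_not_bot by metis
qed

lemma typical_weight_pos: "typical_weight v \<Longrightarrow> z \<in> ball 0 1 \<Longrightarrow> 0 < v z"
  unfolding typical_weight_def by blast

lemma Bv_holomorphic: "g \<in> Bv v \<Longrightarrow> g holomorphic_on ball 0 1"
  unfolding Bv_def HD_def by auto

lemma Bv_bdd_above: "g \<in> Bv v \<Longrightarrow> bdd_above ((\<lambda>z. v z * cmod (deriv g z)) ` ball 0 1)"
  unfolding Bv_def by (auto intro: bdd_aboveI2)

lemma Bv_weighted_deriv_le_norm:
  assumes "g \<in> Bv v" "z \<in> ball 0 1"
  shows "v z * cmod (deriv g z) \<le> Bv_norm v g"
proof -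
  have "v z * cmod (deriv g z) \<le> (SUP z\<in>ball 0 1. v z * cmod (deriv g z))"
    using cSUP_upper[OF assms(2) Bv_bdd_above[OF assms(1)]] .
  then show ?thesis unfolding Bv_norm_def by (smt (verit) norm_ge_zero)
qed

lemma Bv_value0_le_norm:
  assumes "typical_weight v" "g \<in> Bv v"
  shows "cmod (g 0) \<le> Bv_norm v g"
proof -
  have "v 0 * cmod (deriv g 0) \<le> (SUP z\<in>ball 0 1. v z * cmod (deriv g z))"
    using cSUP_upper[OF _ Bv_bdd_above[OF assms(2)]] by simp
  moreover have "0 \<le> v 0 * cmod (deriv g 0)" using typical_weight_pos[OF assms(1), of 0] by simp
  ultimately show ?thesis unfolding Bv_norm_def by linarith
qed

lemma Bv_norm_scaleR_le:
  assumes g: "g \<in> Bv v" and f: "f holomorphic_on ball 0 1"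
    and eq: "\<forall>z\<in>ball 0 1. g z = of_real t * f z" and t: "0 < t"
  shows "t * Bv_norm v f \<le> Bv_norm v g"
proof -
  have "deriv g z = of_real t * deriv f z" if z: "z \<in> ball 0 1" for z
  proof -
    have "((\<lambda>w. of_real t * f w) has_field_derivative of_real t * deriv f z) (at z)"
      using holomorphic_derivI[OF f _ z] by (auto intro!: derivative_eq_intros)
    then have "(g has_field_derivative of_real t * deriv f z) (at z)"
      by (rule has_field_derivative_transform_within_open[of _ _ _ "ball 0 1"]) (use eq z in auto)
    then show ?thesis by (rule DERIV_imp_deriv)
  qed
  then have "v z * cmod (deriv f z) \<le> (SUP z\<in>ball 0 1. v z * cmod (deriv g z)) / t"
    if z: "z \<in> ball 0 1" for z
    using cSUP_upper[OF z Bv_bdd_above[OF g]] t z by (simp add: norm_mult field_simps)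
  then have "(SUP z\<in>ball 0 1. v z * cmod (deriv f z)) \<le> (SUP z\<in>ball 0 1. v z * cmod (deriv g z)) / t"
    by (intro cSUP_least) auto
  moreover have "t * cmod (f 0) = cmod (g 0)" using eq t by (simp add: norm_mult)
  ultimately show ?thesis
    using t unfolding Bv_norm_def by (simp add: field_simps distrib_left)
qed

lemma deriv_linear_combination:
  assumes "f holomorphic_on ball 0 1" "g holomorphic_on ball 0 1" "z \<in> ball 0 1"
  shows "deriv (\<lambda>w. a * f w + b * g w) z = a * deriv f z + b * deriv g z"
proof -
  have "(f has_field_derivative deriv f z) (at z)" "(g has_field_derivative deriv g z) (at z)"
    using holomorphic_derivI assms by blast+
  then have "((\<lambda>w. a * f w + b * g w) has_field_derivative (a * deriv f z + b * deriv g z)) (at z)"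
    by (auto intro!: derivative_eq_intros)
  then show ?thesis by (rule DERIV_imp_deriv)
qed

lemma weighted_deriv_linear_combination:
  assumes "f \<in> Bv v" "g \<in> Bv v" "z \<in> ball 0 1"
  shows "w * (v z * deriv (\<lambda>x. a * f x + b * g x) z) =
    a * (w * (v z * deriv f z)) + b * (w * (v z * deriv g z))"
  using deriv_linear_combination[OF Bv_holomorphic Bv_holomorphic, OF assms]
  by (simp add: algebra_simps)

lemma weighted_deriv_norm_le:
  assumes "typical_weight v" "g \<in> Bv v" "z \<in> ball 0 1"
  shows "cmod (w * (v z * deriv g z)) \<le> cmod w * Bv_norm v g"
proof -
  have "cmod (w * (v z * deriv g z)) = cmod w * (v z * cmod (deriv g z))"
    using typical_weight_pos[OF assms(1,3)] by (simp add: norm_mult)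
  also have "\<dots> \<le> cmod w * Bv_norm v g"
    by (intro mult_left_mono Bv_weighted_deriv_le_norm assms(2,3)) simp
  finally show ?thesis .
qed

lemma Bv_dual_weighted_deriv:
  assumes "typical_weight v" "z \<in> ball 0 1"
  shows "(\<lambda>g. v z * deriv g z) \<in> Bv_dual v"
  unfolding Bv_dual_def
  using weighted_deriv_linear_combination[OF _ _ assms(2), where w=1]
    weighted_deriv_norm_le[OF assms(1) _ assms(2), where w=1]
  by (auto intro!: exI[of _ 1])

lemma Bv_dual_value0:
  assumes "typical_weight v"
  shows "(\<lambda>g. g 0) \<in> Bv_dual v"
  unfolding Bv_dual_def using Bv_value0_le_norm[OF assms] by (auto intro!: exI[of _ 1])

lemma Bv_dual_ultrafilter_Lim:
  assumes tw: "typical_weight v" and U: "ultrafilter U"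
    and zs: "\<And>k. zs k \<in> ball 0 1" and w: "\<And>k. cmod (w k) \<le> 1"
  shows "(\<lambda>g. Lim U (\<lambda>k. w k * (v (zs k) * deriv g (zs k)))) \<in> Bv_dual v"
proof -
  have U_not_bot: "U \<noteq> bot" using U by (simp add: ultrafilter_def)
  have bound: "cmod (w k * (v (zs k) * deriv g (zs k))) \<le> Bv_norm v g" if g: "g \<in> Bv v" for g k
  proof -
    have "cmod (w k * (v (zs k) * deriv g (zs k))) \<le> cmod (w k) * Bv_norm v g"
      by (rule weighted_deriv_norm_le[OF tw g zs])
    also have "\<dots> \<le> Bv_norm v g"
      using w[of k] Bv_weighted_deriv_le_norm[OF g zs[of k]] typical_weight_pos[OF tw zs[of k]]
      by (intro mult_left_le_one_le) (auto intro: order_trans[rotated])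
    finally show ?thesis .
  qed
  have lim: "((\<lambda>k. w k * (v (zs k) * deriv g (zs k))) \<longlongrightarrow>
      Lim U (\<lambda>k. w k * (v (zs k) * deriv g (zs k)))) U" if "g \<in> Bv v" for g
    by (rule ultrafilter_tendsto_Lim[OF U]) (use bound[OF that] in \<open>auto simp: bounded_iff\<close>)
  show ?thesis
    unfolding Bv_dual_def
  proof (intro CollectI conjI ballI allI exI)
    fix f g a b assume f: "f \<in> Bv v" and g: "g \<in> Bv v"
    show "Lim U (\<lambda>k. w k * (v (zs k) * deriv (\<lambda>z. a * f z + b * g z) (zs k))) =
        a * Lim U (\<lambda>k. w k * (v (zs k) * deriv f (zs k))) + b * Lim U (\<lambda>k. w k * (v (zs k) * deriv g (zs k)))"
      unfolding weighted_deriv_linear_combination[OF f g zs]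
      by (intro tendsto_Lim U_not_bot tendsto_add tendsto_mult_left lim f g)
  next
    fix f assume f: "f \<in> Bv v"
    show "cmod (Lim U (\<lambda>k. w k * (v (zs k) * deriv f (zs k)))) \<le> 1 * Bv_norm v f"
      using tendsto_upperbound[OF tendsto_norm[OF lim[OF f]] _ U_not_bot] bound[OF f] by simp
  qed
qed

lemma Bv_dual_weighted_deriv_series:
  assumes tw: "typical_weight v" and zs: "\<And>k. zs k \<in> ball 0 1"
    and w: "\<And>k. cmod (w k) \<le> c k" and c: "summable c"
  shows "(\<lambda>g. \<Sum>k. w k * (v (zs k) * deriv g (zs k))) \<in> Bv_dual v"
proof -
  have bound: "cmod (w k * (v (zs k) * deriv g (zs k))) \<le> c k * Bv_norm v g" if g: "g \<in> Bv v" for g k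
  proof -
    have "cmod (w k * (v (zs k) * deriv g (zs k))) \<le> cmod (w k) * Bv_norm v g"
      by (rule weighted_deriv_norm_le[OF tw g zs])
    also have "\<dots> \<le> c k * Bv_norm v g"
      using w[of k] Bv_weighted_deriv_le_norm[OF g zs[of k]] typical_weight_pos[OF tw zs[of k]]
      by (intro mult_right_mono) (auto intro: order_trans[rotated])
    finally show ?thesis .
  qed
  have abs_summable: "summable (\<lambda>k. cmod (w k * (v (zs k) * deriv g (zs k))))" if "g \<in> Bv v" for g
    by (rule summable_comparison_test[of _ "\<lambda>k. c k * Bv_norm v g"])
      (use bound[OF that] summable_mult2[OF c] in auto)
  have sums: "(\<lambda>k. w k * (v (zs k) * deriv g (zs k))) sums (\<Sum>k. w k * (v (zs k) * deriv g (zs k)))"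
    if "g \<in> Bv v" for g
    using summable_sums[OF summable_norm_cancel[OF abs_summable[OF that]]] .
  show ?thesis
    unfolding Bv_dual_def
  proof (intro CollectI conjI ballI allI exI)
    fix f g a b assume f: "f \<in> Bv v" and g: "g \<in> Bv v"
    show "(\<Sum>k. w k * (v (zs k) * deriv (\<lambda>z. a * f z + b * g z) (zs k))) =
        a * (\<Sum>k. w k * (v (zs k) * deriv f (zs k))) + b * (\<Sum>k. w k * (v (zs k) * deriv g (zs k)))"
      unfolding weighted_deriv_linear_combination[OF f g zs]
      by (intro sums_unique[symmetric] sums_add sums_mult sums f g)
  next
    fix f assume f: "f \<in> Bv v"
    have "cmod (\<Sum>k. w k * (v (zs k) * deriv f (zs k))) \<le> (\<Sum>k. cmod (w k * (v (zs k) * deriv f (zs k))))"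
      by (rule summable_norm[OF abs_summable[OF f]])
    also have "\<dots> \<le> (\<Sum>k. c k * Bv_norm v f)"
      by (rule suminf_le) (use bound[OF f] abs_summable[OF f] summable_mult2[OF c] in auto)
    also have "\<dots> = suminf c * Bv_norm v f" by (simp add: suminf_mult2[OF c])
    finally show "cmod (\<Sum>k. w k * (v (zs k) * deriv f (zs k))) \<le> suminf c * Bv_norm v f" .
  qed
qed

lemma topspace_weak_top: "topspace (weak_top v) = Bv v"
  unfolding weak_top_def topspace_pullback_topology topspace_product_topology by auto

lemma continuous_map_weak_top_Bv_dual:
  assumes "\<phi> \<in> Bv_dual v"
  shows "continuous_map (weak_top v) euclidean \<phi>"
proof -
  have "continuous_map (weak_top v) euclidean
      ((\<lambda>x. x \<phi>) \<circ> (\<lambda>f. restrict (\<lambda>\<phi>. \<phi> f) (Bv_dual v)))"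
    unfolding weak_top_def
    by (rule continuous_map_pullback[OF continuous_map_product_projection[OF assms]])
  then show ?thesis
    by (rule continuous_map_eq) (use assms in auto)
qed

lemma compactin_closure_bounded_image:
  fixes \<phi> :: "'a \<Rightarrow> 'b::metric_space"
  assumes "compactin W (W closure_of S)" "S \<subseteq> topspace W" "continuous_map W euclidean \<phi>"
  shows "bounded (\<phi> ` S)"
proof -
  have "compact (\<phi> ` (W closure_of S))"
    using image_compactin[OF assms(1,3)] by simp
  moreover have "S \<subseteq> W closure_of S" using assms(2) by (rule closure_of_subset)
  ultimately show ?thesis by (meson bounded_subset compact_imp_bounded image_mono)
qed

lemma compactin_closure_cluster_point:
  fixes g :: "nat \<Rightarrow> 'a"
  assumes K: "compactin W (W closure_of S)" and S: "S \<subseteq> topspace W" and g: "range g \<subseteq> S"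
  shows "\<exists>p\<in>topspace W. \<forall>n. p \<in> W closure_of (g ` {n..})"
proof -
  define A where "A n = W closure_of (g ` {n..})" for n
  have g_in_A: "g m \<in> A n" if "n \<le> m" for n m
    using that closure_of_subset[of "g ` {n..}" W] g S unfolding A_def by blast
  have "S \<subseteq> W closure_of S" using S by (rule closure_of_subset)
  then have g_in_K: "g m \<in> W closure_of S" for m using g by blast
  have "(W closure_of S) \<inter> \<Inter>F \<noteq> {}" if F: "finite F" "F \<subseteq> range A" for F
  proof -
    obtain I where I: "finite I" "F = A ` I" using finite_subset_image[OF F] by metis
    have "g (if I = {} then 0 else Max I) \<in> \<Inter>F"
      using I by (auto intro!: g_in_A)
    then show ?thesis using g_in_K by blast
  qed
  moreover have "\<forall>C\<in>range A. closedin W C" unfolding A_def by simp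
  ultimately have "(W closure_of S) \<inter> \<Inter>(range A) \<noteq> {}"
    using K unfolding compactin_fip by blast
  moreover have "W closure_of S \<subseteq> topspace W" by (rule closure_of_subset_topspace)
  ultimately show ?thesis unfolding A_def by blast
qed

lemma cluster_point_continuous_map_limit:
  fixes g :: "nat \<Rightarrow> 'a" and \<phi> :: "'a \<Rightarrow> 'b::metric_space"
  assumes \<phi>: "continuous_map W euclidean \<phi>" and p: "\<And>n. p \<in> W closure_of (g ` {n..})"
    and L: "(\<lambda>n. \<phi> (g n)) \<longlonglongrightarrow> L"
  shows "\<phi> p = L"
proof -
  have "dist (\<phi> p) L \<le> e" if e: "e > 0" for e
  proof -
    obtain n0 where n0: "\<And>m. m \<ge> n0 \<Longrightarrow> dist (\<phi> (g m)) L < e"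
      using L e unfolding lim_sequentially by blast
    have "\<phi> p \<in> \<phi> ` (W closure_of (g ` {n0..}))" using p by (rule imageI)
    also have "\<dots> \<subseteq> closure (\<phi> ` g ` {n0..})"
      using continuous_map_image_closure_subset[OF \<phi>] by simp
    also have "\<dots> \<subseteq> cball L e"
      by (rule closure_minimal) (use n0 in \<open>auto simp: dist_commute less_imp_le\<close>)
    finally show ?thesis by (simp add: dist_commute)
  qed
  then show ?thesis by (metis dist_le_zero_iff dist_pos_lt field_lbound_gt_zero not_le)
qed

section \<open>A gliding hump principle\<close>

lemma norm_term_le_norm_suminf_add:
  fixes t :: "nat \<Rightarrow> 'a::banach"
  assumes t: "\<And>k. k \<noteq> n \<Longrightarrow> norm (t k) \<le> b k" and b: "b sums s" "0 \<le> b n"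
  shows "norm (t n) \<le> norm (suminf t) + s"
proof -
  define d where "d k = (if k = n then 0 else t k)" for k
  have d_le: "norm (d k) \<le> b k" for k using t b(2) unfolding d_def by simp
  have d: "summable (\<lambda>k. norm (d k))"
    by (rule summable_comparison_test[OF _ sums_summable[OF b(1)]]) (use d_le in simp)
  have "(\<Sum>k. norm (d k)) \<le> s"
    using suminf_le[OF d_le d sums_summable[OF b(1)]] sums_unique[OF b(1)] by simp
  then have d_bound: "norm (suminf d) \<le> s" using summable_norm[OF d] by linarith
  have "(\<lambda>k. d k + (if k = n then t n else 0)) sums (suminf d + t n)"
    by (rule sums_add[OF summable_sums[OF summable_norm_cancel[OF d]] sums_single])
  moreover have "(\<lambda>k. d k + (if k = n then t n else 0)) = t" by (rule ext) (simp add: d_def)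
  ultimately have "t n = suminf t - suminf d" by (metis sums_unique add_diff_cancel_left')
  then have "norm (t n) \<le> norm (suminf t) + norm (suminf d)"
    by (simp add: norm_triangle_ineq4)
  then show ?thesis using d_bound by linarith
qed

lemma gliding_hump_sequence:
  fixes E :: "'z \<Rightarrow> 'g \<Rightarrow> complex" and M :: "'z \<Rightarrow> real" and Q :: "'g \<Rightarrow> real"
  assumes unbounded: "\<forall>R. \<exists>g\<in>S. \<exists>z\<in>Z. R < cmod (E z g)"
  obtains c gs zs where "\<And>k. 0 < c k" "summable c" "\<And>k. gs k \<in> S" "\<And>k. zs k \<in> Z"
    "\<And>n. real n + (\<Sum>k<n. c k * M (zs k)) + 3 < c n * cmod (E (zs n) (gs n))"
    "\<And>n k. n < k \<Longrightarrow> c k * \<bar>Q (gs n)\<bar> \<le> (1/2)^k"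
proof -
  obtain G Zp where G: "\<And>R. G R \<in> S" "\<And>R. Zp R \<in> Z" "\<And>R. R < cmod (E (Zp R) (G R))"
    using unbounded by metis
  \<comment> \<open>The state after step \<open>n\<close> is \<open>(A n, B n)\<close>; the weight \<open>c n = 1 / (2^n B n)\<close> is small
    against all previously chosen \<open>gs k\<close>, and \<open>(gs n, zs n)\<close> is then chosen to beat \<open>A n\<close>.\<close>
  define st where "st = rec_nat (0::real, 1::real) (\<lambda>n s.
      let c = 1 / (2^n * snd s); R = (real n + fst s + 3) / c
      in (fst s + c * M (Zp R), snd s + \<bar>Q (G R)\<bar>))"
  define A where "A n = fst (st n)" for n
  define B where "B n = snd (st n)" for n
  define c where "c n = 1 / (2^n * B n)" for n
  define R where "R n = (real n + A n + 3) / c n" for n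
  define gs where "gs n = G (R n)" for n
  define zs where "zs n = Zp (R n)" for n
  have A0: "A 0 = 0" and B0: "B 0 = 1" unfolding A_def B_def st_def by simp_all
  have AS: "A (Suc n) = A n + c n * M (zs n)" and BS: "B (Suc n) = B n + \<bar>Q (gs n)\<bar>" for n
    unfolding A_def B_def st_def c_def zs_def gs_def R_def by (simp_all add: A_def B_def st_def Let_def)
  have B1: "1 \<le> B n" for n by (induction n) (auto simp: B0 BS)
  have c_pos: "0 < c n" for n using B1[of n] unfolding c_def by (simp add: less_le_trans[OF zero_less_one])
  have cB: "c k * B k = (1/2)^k" for k
    using B1[of k] unfolding c_def by (simp add: power_one_over)
  have c_le: "norm (c k) \<le> (1/2)^k" for k
    using cB[of k] B1[of k] c_pos[of k] by (smt (verit) mult_le_cancel_left1 real_norm_def)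
  have "summable c"
    by (rule summable_comparison_test'[OF summable_geometric c_le]) simp
  moreover have "gs k \<in> S" "zs k \<in> Z" for k unfolding gs_def zs_def by (rule G(1), rule G(2))
  moreover have "real n + (\<Sum>k<n. c k * M (zs k)) + 3 < c n * cmod (E (zs n) (gs n))" for n
  proof -
    have "A n = (\<Sum>k<n. c k * M (zs k))" by (induction n) (auto simp: A0 AS)
    moreover have "c n * R n = real n + A n + 3" unfolding R_def using c_pos[of n] by simp
    moreover have "R n < cmod (E (zs n) (gs n))" unfolding gs_def zs_def by (rule G(3))
    ultimately show ?thesis using c_pos[of n] by (metis mult_strict_left_mono)
  qed
  moreover have "c k * \<bar>Q (gs n)\<bar> \<le> (1/2)^k" if "n < k" for n k
  proof -
    have "incseq B" by (rule incseq_SucI) (simp add: BS)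
    then have "B (Suc n) \<le> B k" using that by (simp add: incseq_def)
    then have "\<bar>Q (gs n)\<bar> \<le> B k" using BS[of n] B1[of n] by linarith
    then have "c k * \<bar>Q (gs n)\<bar> \<le> c k * B k" using c_pos[of k] by simp
    then show ?thesis by (simp only: cB)
  qed
  ultimately show ?thesis using c_pos by (intro that)
qed

lemma series_bounded_imp_pointwise_bounded:
  fixes E :: "'z \<Rightarrow> 'g \<Rightarrow> complex"
  assumes series: "\<And>c u zs. (\<And>k. 0 \<le> c k) \<Longrightarrow> (\<And>k. cmod (u k) \<le> 1) \<Longrightarrow> (\<And>k. zs k \<in> Z) \<Longrightarrow>
        summable c \<Longrightarrow> \<exists>R. \<forall>g\<in>S. cmod (\<Sum>k. of_real (c k) * u k * E (zs k) g) \<le> R"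
    and z: "z \<in> Z"
  shows "\<exists>m. \<forall>g\<in>S. cmod (E z g) \<le> m"
proof -
  define \<delta> where "\<delta> k = (if k = 0 then 1 else 0 :: real)" for k :: nat
  have "summable \<delta>" unfolding \<delta>_def by (rule summable_If_finite) simp
  then have "\<exists>m. \<forall>g\<in>S. cmod (\<Sum>k. of_real (\<delta> k) * 1 * E z g) \<le> m"
    using series[of \<delta> "\<lambda>_. 1" "\<lambda>_. z"] z by (simp add: \<delta>_def)
  moreover have "(\<Sum>k. of_real (\<delta> k) * 1 * E z g) = E z g" for g
    unfolding \<delta>_def by (subst suminf_finite[of "{0}"]) auto
  ultimately show ?thesis by metis
qed

lemma gliding_hump:
  fixes E :: "'z \<Rightarrow> 'g \<Rightarrow> complex"
  assumes pointwise: "\<forall>g\<in>S. \<exists>q. \<forall>z\<in>Z. cmod (E z g) \<le> q"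
    and series: "\<And>c u zs. (\<And>k. 0 \<le> c k) \<Longrightarrow> (\<And>k. cmod (u k) \<le> 1) \<Longrightarrow> (\<And>k. zs k \<in> Z) \<Longrightarrow>
        summable c \<Longrightarrow> \<exists>R. \<forall>g\<in>S. cmod (\<Sum>k. of_real (c k) * u k * E (zs k) g) \<le> R"
  shows "\<exists>R. \<forall>g\<in>S. \<forall>z\<in>Z. cmod (E z g) \<le> R"
proof (rule ccontr)
  assume "\<not> ?thesis"
  then have unbounded: "\<forall>R. \<exists>g\<in>S. \<exists>z\<in>Z. R < cmod (E z g)" by (meson not_le)
  from bchoice[OF pointwise] obtain Q where Q: "\<forall>g\<in>S. \<forall>z\<in>Z. cmod (E z g) \<le> Q g" ..
  have "\<forall>z\<in>Z. \<exists>m. \<forall>g\<in>S. cmod (E z g) \<le> m"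
    using series_bounded_imp_pointwise_bounded[of Z S E] series by blast
  from bchoice[OF this] obtain M0 where M0: "\<forall>z\<in>Z. \<forall>g\<in>S. cmod (E z g) \<le> M0 z" ..
  define M where "M z = max 0 (M0 z)" for z
  have M: "\<forall>z\<in>Z. \<forall>g\<in>S. cmod (E z g) \<le> M z" "\<And>z. 0 \<le> M z"
    using M0 unfolding M_def by (auto intro: max.coboundedI2)
  obtain c gs zs where c: "\<And>k. 0 < c k" "summable c" and gs: "\<And>k. gs k \<in> S" and zs: "\<And>k. zs k \<in> Z"
    and hump: "\<And>n. real n + (\<Sum>k<n. c k * M (zs k)) + 3 < c n * cmod (E (zs n) (gs n))"
    and tail: "\<And>n k. n < k \<Longrightarrow> c k * \<bar>Q (gs n)\<bar> \<le> (1/2)^k"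
    using gliding_hump_sequence[OF unbounded, of M Q] by blast
  define u where "u k = cnj (sgn (E (zs k) (gs k)))" for k
  have u: "cmod (u k) \<le> 1" for k unfolding u_def by (simp add: norm_sgn)
  obtain Rb where Rb: "\<forall>g\<in>S. cmod (\<Sum>k. of_real (c k) * u k * E (zs k) g) \<le> Rb"
    using series[of c u zs] c u zs by (meson less_imp_le)
  obtain n :: nat where n: "Rb < real n" using reals_Archimedean2 by blast
  define t where "t k = of_real (c k) * u k * E (zs k) (gs n)" for k
  have t_le: "cmod (t k) \<le> c k * cmod (E (zs k) (gs n))" for k
    using u[of k] c(1)[of k] unfolding t_def by (simp add: norm_mult mult_left_le_one_le)
  define b where "b k = (if k < n then c k * M (zs k) else 0) + (1/2::real)^k" for k
  have "(\<lambda>k. (1/2::real)^k) sums 2" using geometric_sums[of "1/2::real"] by simp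
  then have b_sums: "b sums ((\<Sum>k<n. c k * M (zs k)) + 2)"
    unfolding b_def lessThan_iff[symmetric] by (intro sums_add sums_If_finite_set) simp_all
  have b_nonneg: "0 \<le> b n" unfolding b_def by simp
  have t_le_b: "cmod (t k) \<le> b k" if "k \<noteq> n" for k
  proof (cases "k < n")
    case True
    have "cmod (E (zs k) (gs n)) \<le> M (zs k)" using M(1) zs gs by blast
    then have "cmod (t k) \<le> c k * M (zs k)"
      using t_le[of k] mult_left_mono[OF _ less_imp_le[OF c(1)]] by (meson order_trans)
    moreover have "(0::real) \<le> (1/2)^k" by simp
    ultimately show ?thesis using True unfolding b_def by (simp add: add_increasing2)
  next
    case False
    have "cmod (E (zs k) (gs n)) \<le> Q (gs n)" using Q zs gs by blast
    then have "cmod (E (zs k) (gs n)) \<le> \<bar>Q (gs n)\<bar>" by linarith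
    then have "cmod (t k) \<le> c k * \<bar>Q (gs n)\<bar>"
      using t_le[of k] mult_left_mono[OF _ less_imp_le[OF c(1)]] by (meson order_trans)
    also have "\<dots> \<le> (1/2)^k" using False that by (intro tail) simp
    finally show ?thesis using False unfolding b_def by simp
  qed
  have "cmod (t n) \<le> cmod (suminf t) + ((\<Sum>k<n. c k * M (zs k)) + 2)"
    by (rule norm_term_le_norm_suminf_add[OF t_le_b b_sums b_nonneg])
  moreover have "cmod (t n) = c n * cmod (E (zs n) (gs n))"
    using c(1)[of n] unfolding t_def u_def
    by (cases "E (zs n) (gs n) = 0") (simp_all add: norm_mult complex_sgn_def scaleR_conv_of_real complex_norm_square[symmetric] field_simps power2_eq_square)
  moreover have "cmod (suminf t) \<le> Rb" using Rb gs[of n] unfolding t_def by blast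
  ultimately show False using hump[of n] n by linarith
qed

lemma Bv_norm_bounded_if_weakly_bounded:
  assumes tw: "typical_weight v" and S: "S \<subseteq> Bv v"
    and weakly_bounded: "\<And>\<phi>. \<phi> \<in> Bv_dual v \<Longrightarrow> bounded (\<phi> ` S)"
  shows "\<exists>R. \<forall>g\<in>S. Bv_norm v g \<le> R"
proof -
  obtain R0 where R0: "\<forall>g\<in>S. cmod (g 0) \<le> R0"
    using weakly_bounded[OF Bv_dual_value0[OF tw]] by (auto simp: bounded_iff)
  have "\<exists>R. \<forall>g\<in>S. \<forall>z\<in>ball 0 1. cmod (v z * deriv g z) \<le> R"
  proof (rule gliding_hump)
    show "\<forall>g\<in>S. \<exists>q. \<forall>z\<in>ball 0 1. cmod (v z * deriv g z) \<le> q"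
      using Bv_weighted_deriv_le_norm S typical_weight_pos[OF tw]
      by (fastforce simp: norm_mult)
  next
    fix c :: "nat \<Rightarrow> real" and u :: "nat \<Rightarrow> complex" and zs :: "nat \<Rightarrow> complex"
    assume c: "\<And>k. 0 \<le> c k" "summable c" and u: "\<And>k. cmod (u k) \<le> 1" and zs: "\<And>k. zs k \<in> ball 0 1"
    have "cmod (of_real (c k) * u k) \<le> c k" for k
      using c(1)[of k] u[of k] by (simp add: norm_mult mult_left_le)
    then have "(\<lambda>g. \<Sum>k. of_real (c k) * u k * (v (zs k) * deriv g (zs k))) \<in> Bv_dual v"
      by (rule Bv_dual_weighted_deriv_series[OF tw zs _ c(2)])
    then show "\<exists>R. \<forall>g\<in>S. cmod (\<Sum>k. of_real (c k) * u k * (v (zs k) * deriv g (zs k))) \<le> R"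
      using weakly_bounded by (auto simp: bounded_iff)
  qed
  then obtain R1 where R1: "\<forall>g\<in>S. \<forall>z\<in>ball 0 1. v z * cmod (deriv g z) \<le> R1"
    using typical_weight_pos[OF tw] by (fastforce simp: norm_mult)
  have "Bv_norm v g \<le> R0 + R1" if "g \<in> S" for g
  proof -
    have "(SUP z\<in>ball 0 1. v z * cmod (deriv g z)) \<le> R1"
      using R1 that by (intro cSUP_least) auto
    then show ?thesis using R0 that unfolding Bv_norm_def by fastforce
  qed
  then show ?thesis by blast
qed

section \<open>The little weighted Bloch space is weakly closed\<close>

lemma not_Bv0_witness_sequence:
  assumes "h \<in> HD" "h \<notin> Bv0 v"
  obtains e zs where "0 < e" "\<And>k. zs k \<in> ball 0 1"
    "\<And>k. e \<le> v (zs k) * cmod (deriv h (zs k))" "(\<lambda>k. norm (zs k)) \<longlonglongrightarrow> 1"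
proof -
  obtain e where e: "0 < e"
    "\<And>\<delta>. \<delta> < 1 \<Longrightarrow> \<exists>z. \<delta> < norm z \<and> norm z < 1 \<and> e \<le> v z * cmod (deriv h z)"
    using assms unfolding Bv0_def by (auto simp: not_less) (meson not_le)
  have "\<forall>k. \<exists>z. 1 - inverse (real (Suc k)) < norm z \<and> norm z < 1 \<and> e \<le> v z * cmod (deriv h z)"
    using e(2) by simp
  from choice[OF this] obtain zs where zs: "\<And>k. 1 - inverse (real (Suc k)) < norm (zs k) \<and>
      norm (zs k) < 1 \<and> e \<le> v (zs k) * cmod (deriv h (zs k))"
    by blast
  have "(\<lambda>k. norm (zs k)) \<longlonglongrightarrow> 1"
  proof (rule tendsto_sandwich[OF _ _ _ tendsto_const])
    show "(\<lambda>k. 1 - inverse (real (Suc k))) \<longlonglongrightarrow> 1"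
      using LIMSEQ_inverse_real_of_nat_add_minus[of 1] by simp
  qed (use zs in \<open>auto intro!: always_eventually less_imp_le\<close>)
  moreover have "zs k \<in> ball 0 1" "e \<le> v (zs k) * cmod (deriv h (zs k))" for k using zs[of k] by auto
  ultimately show ?thesis using that[OF e(1)] by blast
qed

lemma Bv0_weighted_deriv_tendsto_zero:
  assumes tw: "typical_weight v" and h: "h \<in> Bv0 v"
    and zs: "\<And>k. zs k \<in> ball 0 1" "(\<lambda>k. norm (zs k)) \<longlonglongrightarrow> 1" and w: "\<And>k. cmod (w k) \<le> 1"
  shows "(\<lambda>k. w k * (v (zs k) * deriv h (zs k))) \<longlonglongrightarrow> 0"
proof (rule Lim_null_comparison)
  show "\<forall>\<^sub>F k in sequentially. norm (w k * (v (zs k) * deriv h (zs k))) \<le> v (zs k) * cmod (deriv h (zs k))"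
    using w typical_weight_pos[OF tw zs(1)]
    by (intro always_eventually allI) (simp add: norm_mult abs_of_pos less_imp_le mult_left_le_one_le)
  show "(\<lambda>k. v (zs k) * cmod (deriv h (zs k))) \<longlonglongrightarrow> 0"
  proof (rule tendstoI)
    fix e :: real assume "0 < e"
    then obtain \<delta> where \<delta>: "\<delta> < 1" "\<And>z. \<delta> < norm z \<and> norm z < 1 \<Longrightarrow> v z * cmod (deriv h z) < e"
      using h unfolding Bv0_def by blast
    have "\<forall>\<^sub>F k in sequentially. \<delta> < norm (zs k)" using order_tendstoD(1)[OF zs(2) \<delta>(1)] .
    then show "\<forall>\<^sub>F k in sequentially. dist (v (zs k) * cmod (deriv h (zs k))) 0 < e"
      by eventually_elim (use \<delta>(2) zs(1) typical_weight_pos[OF tw zs(1)] in \<open>auto simp: abs_of_nonneg less_imp_le\<close>)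
  qed
qed

lemma Bv0_weak_cluster_point:
  assumes tw: "typical_weight v" and p: "p \<in> Bv v" and g: "\<And>n. g n \<in> Bv0 v"
    and cluster: "\<And>\<phi> L. \<phi> \<in> Bv_dual v \<Longrightarrow> (\<lambda>n. \<phi> (g n)) \<longlonglongrightarrow> L \<Longrightarrow> \<phi> p = L"
  shows "p \<in> Bv0 v"
proof (rule ccontr)
  assume "p \<notin> Bv0 v"
  moreover have "p \<in> HD" using p unfolding Bv_def by simp
  ultimately obtain e zs where e: "0 < e" and zs: "\<And>k. zs k \<in> ball 0 1"
    "\<And>k. e \<le> v (zs k) * cmod (deriv p (zs k))" "(\<lambda>k. norm (zs k)) \<longlonglongrightarrow> 1"
    using not_Bv0_witness_sequence by metis
  \<comment> \<open>A Banach-limit type functional: it annihilates \<open>Bv0 v\<close> but not \<open>p\<close>.\<close>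
  define w where "w k = cnj (sgn (deriv p (zs k)))" for k
  have w: "cmod (w k) \<le> 1" for k unfolding w_def by (simp add: norm_sgn)
  obtain U :: "nat filter" where U: "U \<le> sequentially" "ultrafilter U"
    using exists_ultrafilter_le[of sequentially] by auto
  have U_not_bot: "U \<noteq> bot" using U(2) unfolding ultrafilter_def by simp
  define \<psi> where "\<psi> h = Lim U (\<lambda>k. w k * (v (zs k) * deriv h (zs k)))" for h
  have \<psi>: "\<psi> \<in> Bv_dual v" unfolding \<psi>_def[abs_def]
    by (rule Bv_dual_ultrafilter_Lim[OF tw U(2) zs(1) w])
  have "\<psi> (g n) = 0" for n
    unfolding \<psi>_def
    by (rule tendsto_Lim[OF U_not_bot tendsto_mono[OF U(1)]])
      (rule Bv0_weighted_deriv_tendsto_zero[OF tw g zs(1) zs(3) w])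
  then have "\<psi> p = 0" using cluster[OF \<psi>] by simp
  moreover have "\<psi> p \<noteq> 0"
  proof -
    define x where "x k = w k * (v (zs k) * deriv p (zs k))" for k
    have x: "x k = of_real (v (zs k) * cmod (deriv p (zs k)))" for k
      unfolding x_def w_def
      by (cases "deriv p (zs k) = 0") (simp_all add: complex_sgn_def scaleR_conv_of_real complex_norm_square[symmetric] field_simps power2_eq_square)
    have "cmod (x k) \<le> Bv_norm v p" for k
      using Bv_weighted_deriv_le_norm[OF p zs(1), of k] typical_weight_pos[OF tw zs(1), of k]
      unfolding x norm_of_real by (simp add: abs_of_nonneg)
    then have "(x \<longlongrightarrow> \<psi> p) U"
      unfolding \<psi>_def x_def[symmetric] by (intro ultrafilter_tendsto_Lim[OF U(2)]) (auto simp: bounded_iff)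
    then have "e \<le> Re (\<psi> p)"
      by (rule tendsto_lowerbound[OF tendsto_Re _ U_not_bot]) (simp add: x zs(2))
    then show ?thesis using e by auto
  qed
  ultimately show False by simp
qed

lemma Bv0_deriv_cong:
  assumes g: "g \<in> Bv0 v" and f: "f \<in> HD" and deriv_eq: "\<forall>z\<in>ball 0 1. deriv f z = a * deriv g z"
  shows "f \<in> Bv0 v"
  unfolding Bv0_def
proof (intro CollectI conjI f allI impI)
  fix e :: real assume e: "0 < e"
  then have "0 < e / (cmod a + 1)" by (simp add: add_nonneg_pos)
  then obtain \<delta> where \<delta>: "\<delta> < 1"
    "\<And>z. \<delta> < norm z \<and> norm z < 1 \<Longrightarrow> v z * cmod (deriv g z) < e / (cmod a + 1)"
    using g unfolding Bv0_def by blast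
  show "\<exists>\<delta><1. \<forall>z. \<delta> < cmod z \<and> cmod z < 1 \<longrightarrow> v z * cmod (deriv f z) < e"
  proof (intro exI[of _ \<delta>] conjI allI impI \<delta>(1))
    fix z assume z: "\<delta> < cmod z \<and> cmod z < 1"
    have "v z * cmod (deriv f z) = cmod a * (v z * cmod (deriv g z))"
      using deriv_eq z by (simp add: norm_mult)
    also have "\<dots> \<le> cmod a * (e / (cmod a + 1))"
      using \<delta>(2)[OF z] by (intro mult_left_mono) auto
    also have "\<dots> < e" using e by (simp add: field_simps add_pos_nonneg)
    finally show "v z * cmod (deriv f z) < e" .
  qed
qed

lemma banach_fun_space_scale:
  assumes "banach_fun_space X N" "f \<in> X"
  shows "(\<lambda>z. a * f z) \<in> X"
proof -
  have "(\<lambda>z. a * f z + 0 * f z) \<in> X" using assms unfolding banach_fun_space_def by blast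
  then show ?thesis by simp
qed

lemma intrinsic_scale:
  assumes "intrinsic T" "f \<in> HD" "z \<in> ball 0 1"
  shows "T (\<lambda>w. a * f w) z = a * T f z"
proof -
  have "T (\<lambda>w. a * f w + 0 * f w) z = a * T f z + 0 * T f z"
    using assms unfolding intrinsic_def by blast
  then show ?thesis by simp
qed

lemma deriv_scale_on_unit_disc:
  assumes g: "g holomorphic_on ball 0 1" and h: "\<forall>w\<in>ball 0 1. h w = a * g w" and z: "z \<in> ball 0 1"
  shows "deriv h z = a * deriv g z"
proof -
  have "((\<lambda>w. a * g w) has_field_derivative a * deriv g z) (at z)"
    using holomorphic_derivI[OF g _ z] by (auto intro!: derivative_eq_intros)
  then have "(h has_field_derivative a * deriv g z) (at z)"
    by (rule has_field_derivative_transform_within_open[of _ _ _ "ball 0 1"]) (use h z in auto)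
  then show ?thesis by (rule DERIV_imp_deriv)
qed

lemma HD_dilation:
  assumes f: "f \<in> HD" and r: "0 \<le> r" "r \<le> 1"
  shows "(\<lambda>z. f (of_real r * z)) \<in> HD"
proof -
  have "of_real r * z \<in> ball 0 1" if "z \<in> ball 0 1" for z :: complex
    using r that by (simp add: norm_mult abs_of_nonneg) (meson le_less_trans mult_left_le_one_le norm_ge_zero)
  then have "(\<lambda>z. of_real r * z) ` ball 0 1 \<subseteq> (ball 0 1 :: complex set)" by blast
  moreover have "(\<lambda>z. of_real r * z) holomorphic_on ball 0 1" by (intro holomorphic_intros)
  moreover have "f holomorphic_on ball 0 1" using f unfolding HD_def by simp
  ultimately show ?thesis
    unfolding HD_def using holomorphic_on_compose_gen[of "\<lambda>z. of_real r * z" "ball 0 1" f "ball 0 1"]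
    by (simp add: o_def)
qed

lemma compact_subset_unit_disc_cball:
  assumes "compact K" "K \<subseteq> ball (0::complex) 1"
  obtains \<rho> where "\<rho> < 1" "K \<subseteq> cball 0 \<rho>"
proof (cases "K = {}")
  case False
  obtain x where x: "x \<in> K" "\<forall>y\<in>K. norm y \<le> norm x"
    using continuous_attains_sup[OF assms(1) False, of norm] by (auto intro: continuous_intros)
  moreover have "K \<subseteq> cball 0 (norm x)" using x(2) by auto
  ultimately show ?thesis using that[of "norm x"] x(1) assms(2) by auto
qed (use that[of 0] in auto)

lemma uc_conv_dilations:
  assumes f: "f \<in> HD" and r: "\<And>n. 0 \<le> r n \<and> r n \<le> 1" and r_lim: "r \<longlonglongrightarrow> 1"
  shows "uc_conv (\<lambda>n z. f (of_real (r n) * z)) f"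
  unfolding uc_conv_def
proof (intro allI impI)
  fix K :: "complex set" assume K: "compact K \<and> K \<subseteq> ball 0 1"
  obtain \<rho> where \<rho>: "\<rho> < 1" "K \<subseteq> cball 0 \<rho>" using compact_subset_unit_disc_cball K by metis
  have "cball 0 \<rho> \<subseteq> ball (0::complex) 1" using \<rho>(1) by auto
  then have "f holomorphic_on cball 0 \<rho>"
    using f unfolding HD_def by (auto intro: holomorphic_on_subset)
  then have "continuous_on (cball 0 \<rho>) f" by (rule holomorphic_on_imp_continuous_on)
  then have uc: "uniformly_continuous_on (cball 0 \<rho>) f"
    by (rule compact_uniformly_continuous) simp
  show "uniform_limit K (\<lambda>n z. f (of_real (r n) * z)) f sequentially"
    unfolding uniform_limit_sequentially_iff
  proof (intro allI impI)
    fix e :: real assume e: "e > 0"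
    obtain d where d: "d > 0"
      "\<And>x y. x \<in> cball 0 \<rho> \<Longrightarrow> y \<in> cball 0 \<rho> \<Longrightarrow> dist y x < d \<Longrightarrow> dist (f y) (f x) < e"
      using uc e unfolding uniformly_continuous_on_def by metis
    obtain n0 where n0: "\<And>n. n \<ge> n0 \<Longrightarrow> dist (r n) 1 < d"
      using r_lim d(1) unfolding lim_sequentially by metis
    show "\<exists>n0. \<forall>n\<ge>n0. \<forall>x\<in>K. dist (f (of_real (r n) * x)) (f x) < e"
    proof (intro exI allI impI ballI)
      fix n x assume n: "n0 \<le> n" and x: "x \<in> K"
      have x\<rho>: "x \<in> cball 0 \<rho>" using x \<rho> by auto
      have "norm (of_real (r n) * x) \<le> norm x" using r[of n] by (simp add: norm_mult mult_left_le_one_le)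
      then have rx\<rho>: "of_real (r n) * x \<in> cball 0 \<rho>" using x\<rho> by simp
      have "of_real (r n) * x - x = - (of_real (1 - r n) * x)" by (simp add: algebra_simps)
      then have "dist (of_real (r n) * x) x = \<bar>1 - r n\<bar> * norm x"
        by (simp only: dist_norm norm_minus_cancel norm_mult norm_of_real)
      also have "\<dots> \<le> \<bar>1 - r n\<bar>" using x\<rho> \<rho>(1) by (intro mult_left_le) auto
      also have "\<dots> < d" using n0[OF n] by (simp add: dist_real_def abs_minus_commute)
      finally show "dist (f (of_real (r n) * x)) (f x) < e" using d(2)[OF x\<rho> rx\<rho>] by simp
    qed
  qed
qed

lemma intrinsic_uc_conv:
  assumes T: "intrinsic T" and F: "\<And>n. F n \<in> HD" and g: "g \<in> HD" and F_lim: "uc_conv F g"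
  shows "uc_conv (\<lambda>n. T (F n)) (T g)"
proof -
  \<comment> \<open>Interleaving \<open>F\<close> with the constant sequence \<open>g\<close> identifies the limit provided by \<open>intrinsic\<close>.\<close>
  define F' where "F' n = (if even n then F (n div 2) else g)" for n
  have "uc_conv F' g"
    unfolding uc_conv_def uniform_limit_sequentially_iff
  proof (intro allI impI)
    fix K :: "complex set" and e :: real assume K: "compact K \<and> K \<subseteq> ball 0 1" and e: "e > 0"
    have "uniform_limit K F g sequentially" using F_lim K unfolding uc_conv_def by blast
    then obtain n0 where n0: "\<And>n x. n \<ge> n0 \<Longrightarrow> x \<in> K \<Longrightarrow> dist (F n x) (g x) < e"
      using e unfolding uniform_limit_sequentially_iff by metis
    show "\<exists>n0. \<forall>n\<ge>n0. \<forall>x\<in>K. dist (F' n x) (g x) < e"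
      using n0 e unfolding F'_def by (intro exI[of _ "2 * n0"]) auto
  qed
  moreover have "\<forall>n. F' n \<in> HD" using F g unfolding F'_def by simp
  ultimately obtain h where h: "uc_conv (\<lambda>n. T (F' n)) h"
    using T g unfolding intrinsic_def by blast
  show ?thesis
    unfolding uc_conv_def
  proof (intro allI impI)
    fix K :: "complex set" assume K: "compact K \<and> K \<subseteq> ball 0 1"
    have u: "uniform_limit K (\<lambda>n. T (F' n)) h sequentially" using h K unfolding uc_conv_def by blast
    have "uniform_limit K (\<lambda>n. T (F' (2 * n))) h sequentially"
      "uniform_limit K (\<lambda>n. T (F' (2 * n + 1))) h sequentially"
      by (rule filterlim_compose[OF u filterlim_subseq, unfolded o_def], simp add: strict_mono_def)+
    then have even: "uniform_limit K (\<lambda>n. T (F n)) h sequentially"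
      and odd: "uniform_limit K (\<lambda>n. T g) h sequentially"
      unfolding F'_def by simp_all
    have "h x = T g x" if "x \<in> K" for x
      using LIMSEQ_unique[OF tendsto_uniform_limitI[OF odd that] tendsto_const] .
    then show "uniform_limit K (\<lambda>n. T (F n)) (T g) sequentially"
      using even uniform_limit_cong'[of K "\<lambda>n. T (F n)" "\<lambda>n. T (F n)" h "T g"] by blast
  qed
qed

lemma uc_conv_deriv:
  assumes G: "\<And>n. G n \<in> HD" and h: "h \<in> HD" and G_lim: "uc_conv G h" and z: "z \<in> ball 0 1"
  shows "(\<lambda>n. deriv (G n) z) \<longlonglongrightarrow> deriv h z"
proof -
  define r where "r = (1 - norm z) / 2"
  have r: "0 < r" using z unfolding r_def by simp
  have sub: "cball z r \<subseteq> ball 0 1"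
  proof
    fix x assume "x \<in> cball z r"
    then have "norm (z - x) \<le> r" by (simp add: dist_norm)
    moreover have "norm x \<le> norm z + norm (z - x)" using norm_triangle_ineq4[of z "z - x"] by simp
    ultimately show "x \<in> ball 0 1" using z unfolding r_def by simp
  qed
  have lim: "uniform_limit (cball z r) G h sequentially" using G_lim sub unfolding uc_conv_def by simp
  have ev: "\<forall>\<^sub>F n in sequentially. continuous_on (cball z r) (G n) \<and>
      (\<forall>w \<in> ball z r. (G n has_field_derivative deriv (G n) w) (at w))"
  proof (rule always_eventually, intro allI conjI ballI)
    fix n
    have hol: "G n holomorphic_on ball 0 1" using G unfolding HD_def by simp
    then show "continuous_on (cball z r) (G n)"
      using sub by (auto intro: holomorphic_on_imp_continuous_on holomorphic_on_subset)
    fix w assume "w \<in> ball z r"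
    then have "w \<in> ball 0 1" using sub ball_subset_cball[of z r] by blast
    then show "(G n has_field_derivative deriv (G n) w) (at w)" using holomorphic_derivI[OF hol] by simp
  qed
  obtain g' where
    g': "\<And>w. w \<in> ball z r \<Longrightarrow> (h has_field_derivative g' w) (at w) \<and> ((\<lambda>n. deriv (G n) w) \<longlongrightarrow> g' w) sequentially"
    using has_complex_derivative_uniform_limit[OF ev lim trivial_limit_sequentially r] by metis
  have "z \<in> ball z r" using r by simp
  then show ?thesis using g' DERIV_imp_deriv by metis
qed

section \<open>Weakly compact intrinsic operators\<close>

lemma intrinsic_Bv0_if_dilations_weakly_compact:
  assumes tw: "typical_weight v" and T: "intrinsic T" and f: "f \<in> HD"
    and K: "compactin (weak_top v) (weak_top v closure_of S)" and S: "S \<subseteq> Bv v"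
    and dilations: "\<And>r. 0 \<le> r \<Longrightarrow> r < 1 \<Longrightarrow> T (\<lambda>z. f (of_real r * z)) \<in> S \<inter> Bv0 v"
  shows "T f \<in> Bv0 v"
proof -
  define r where "r n = 1 - inverse (real (Suc n))" for n
  have r: "0 \<le> r n" "r n < 1" for n unfolding r_def by (simp_all add: inverse_le_1_iff)
  have r_lim: "r \<longlonglongrightarrow> 1" unfolding r_def using LIMSEQ_inverse_real_of_nat_add_minus[of 1] by simp
  define g where "g n = T (\<lambda>z. f (of_real (r n) * z))" for n
  have g: "g n \<in> S" "g n \<in> Bv0 v" "g n \<in> HD" for n
    using dilations[OF r] unfolding g_def Bv0_def by auto
  have Tf: "T f \<in> HD" using T f unfolding intrinsic_def by blast
  have dilations_HD: "(\<lambda>z. f (of_real (r n) * z)) \<in> HD" for n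
    using HD_dilation[OF f] r by (simp add: less_imp_le)
  have "uc_conv (\<lambda>n z. f (of_real (r n) * z)) f"
    by (rule uc_conv_dilations[OF f _ r_lim]) (use r in \<open>simp add: less_imp_le\<close>)
  then have g_lim: "uc_conv g (T f)"
    unfolding g_def by (rule intrinsic_uc_conv[OF T dilations_HD f])
  have "range g \<subseteq> S" using g(1) by blast
  then obtain p where p: "p \<in> Bv v" "\<And>n. p \<in> weak_top v closure_of (g ` {n..})"
    using compactin_closure_cluster_point[OF K] S unfolding topspace_weak_top by blast
  have cluster: "\<phi> p = L" if "\<phi> \<in> Bv_dual v" "(\<lambda>n. \<phi> (g n)) \<longlonglongrightarrow> L" for \<phi> L
    by (rule cluster_point_continuous_map_limit[of "weak_top v" \<phi> p g L])
      (use continuous_map_weak_top_Bv_dual that p(2) in auto)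
  have "p \<in> Bv0 v"
    by (rule Bv0_weak_cluster_point[of v p g]) (use tw p(1) g(2) cluster in auto)
  moreover have "deriv (T f) z = 1 * deriv p z" if z: "z \<in> ball 0 1" for z
  proof -
    have "(\<lambda>n. v z * deriv (g n) z) \<longlonglongrightarrow> v z * deriv (T f) z"
      by (intro tendsto_mult_left uc_conv_deriv[OF g(3) Tf g_lim z])
    then have "v z * deriv p z = v z * deriv (T f) z"
      by (rule cluster[OF Bv_dual_weighted_deriv[OF tw z]])
    then show ?thesis using typical_weight_pos[OF tw z] by simp
  qed
  ultimately show ?thesis using Bv0_deriv_cong Tf by blast
qed

lemma weakly_compact_op_image_Bv0:
  assumes tw: "typical_weight v" and X: "banach_fun_space X N"
    and dilation_X: "\<forall>f\<in>X. \<forall>r::real. 0 \<le> r \<and> r < 1 \<longrightarrow> (\<lambda>z. f (of_real r * z)) \<in> X"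
    and dilation_bounded: "\<exists>C. \<forall>f\<in>X. \<forall>r::real. 0 \<le> r \<and> r < 1 \<longrightarrow> N (\<lambda>z. f (of_real r * z)) \<le> C * N f"
    and T: "intrinsic T"
    and dilation_Bv0: "\<forall>f\<in>X. \<forall>r::real. 0 \<le> r \<and> r < 1 \<longrightarrow> T (\<lambda>z. f (of_real r * z)) \<in> Bv0 v"
    and wc: "weakly_compact_op T X N v"
  shows "T ` X \<subseteq> Bv0 v"
proof (rule image_subsetI)
  fix f assume f: "f \<in> X"
  have N_nonneg: "\<And>f. f \<in> X \<Longrightarrow> 0 \<le> N f" and N_scale: "\<And>f a. f \<in> X \<Longrightarrow> N (\<lambda>z. a * f z) = cmod a * N f"
    and X_HD: "X \<subseteq> HD" using X unfolding banach_fun_space_def by blast+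
  obtain C0 where C0: "\<forall>f\<in>X. \<forall>r::real. 0 \<le> r \<and> r < 1 \<longrightarrow> N (\<lambda>z. f (of_real r * z)) \<le> C0 * N f"
    using dilation_bounded by blast
  define C where "C = max C0 1"
  have C: "N (\<lambda>z. g (of_real r * z)) \<le> C * N g" if "g \<in> X" "0 \<le> r" "r < 1" for g r
    using C0 that mult_right_mono[OF max.cobounded1 N_nonneg[OF that(1)], of C0 1] unfolding C_def
    by fastforce
  have "1 \<le> C" unfolding C_def by simp
  \<comment> \<open>Rescale \<open>f\<close> so that all its dilations lie in the unit ball of \<open>X\<close>.\<close>
  define t where "t = 1 / (C * (N f + 1))"
  have "0 < C * (N f + 1)" using \<open>1 \<le> C\<close> N_nonneg[OF f] by (intro mult_pos_pos) auto
  moreover have "C * t = 1 / (N f + 1)" using \<open>1 \<le> C\<close> unfolding t_def by simp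
  then have "C * (t * N f) = N f / (N f + 1)" by (simp add: mult.assoc[symmetric])
  ultimately have t: "0 < t" "C * (t * N f) \<le> 1"
    using N_nonneg[OF f] unfolding t_def by simp_all
  define ft where "ft z = of_real t * f z" for z
  have ft: "ft \<in> X" "N ft = t * N f"
    using banach_fun_space_scale[OF X f] N_scale[OF f] t(1) unfolding ft_def by simp_all
  have "T ft \<in> Bv0 v"
  proof (rule intrinsic_Bv0_if_dilations_weakly_compact[OF tw T])
    show "ft \<in> HD" using ft X_HD by blast
    show "compactin (weak_top v) (weak_top v closure_of T ` {f \<in> X. N f \<le> 1})"
      and "T ` {f \<in> X. N f \<le> 1} \<subseteq> Bv v" using wc unfolding weakly_compact_op_def by auto
    fix r :: real assume r: "0 \<le> r" "r < 1"
    have "N (\<lambda>z. ft (of_real r * z)) \<le> 1"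
      using C[OF ft(1) r] t(2) ft(2) by simp
    then show "T (\<lambda>z. ft (of_real r * z)) \<in> T ` {f \<in> X. N f \<le> 1} \<inter> Bv0 v"
      using dilation_X dilation_Bv0 ft(1) r by blast
  qed
  moreover have "\<forall>z\<in>ball 0 1. T f z = of_real (1 / t) * T ft z"
    using intrinsic_scale[OF T, of ft _ "of_real (1 / t)"] ft X_HD t(1) unfolding ft_def
    by (simp add: subset_iff)
  then have "\<forall>z\<in>ball 0 1. deriv (T f) z = of_real (1 / t) * deriv (T ft) z"
    using deriv_scale_on_unit_disc[of "T ft"] \<open>T ft \<in> Bv0 v\<close> unfolding Bv0_def HD_def by blast
  moreover have "T f \<in> HD" using T f X_HD unfolding intrinsic_def by blast
  ultimately show "T f \<in> Bv0 v" using Bv0_deriv_cong by blast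
qed

lemma weakly_compact_op_bounded:
  assumes tw: "typical_weight v" and X: "banach_fun_space X N" and T: "intrinsic T"
    and wc: "weakly_compact_op T X N v"
  shows "\<exists>C. \<forall>f\<in>X. Bv_norm v (T f) \<le> C * N f"
proof -
  have N_nonneg: "\<And>f. f \<in> X \<Longrightarrow> 0 \<le> N f" and N_scale: "\<And>f a. f \<in> X \<Longrightarrow> N (\<lambda>z. a * f z) = cmod a * N f"
    and X_HD: "X \<subseteq> HD" using X unfolding banach_fun_space_def by blast+
  define S where "S = T ` {f \<in> X. N f \<le> 1}"
  have K: "compactin (weak_top v) (weak_top v closure_of S)" and S: "S \<subseteq> Bv v"
    using wc unfolding weakly_compact_op_def S_def by auto
  have "bounded (\<phi> ` S)" if "\<phi> \<in> Bv_dual v" for \<phi>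
    using compactin_closure_bounded_image[OF K _ continuous_map_weak_top_Bv_dual[OF that]] S
    by (simp add: topspace_weak_top)
  then obtain R0 where R0: "\<forall>g\<in>S. Bv_norm v g \<le> R0"
    using Bv_norm_bounded_if_weakly_bounded[OF tw S] by blast
  define R where "R = max R0 0"
  have R: "\<And>g. g \<in> S \<Longrightarrow> Bv_norm v g \<le> R" "0 \<le> R" using R0 unfolding R_def by force+
  have scaled: "t * Bv_norm v (T f) \<le> R" if f: "f \<in> X" and t: "0 < t" "t * N f \<le> 1" for f t
  proof -
    have "(\<lambda>z. of_real t * f z) \<in> X" by (rule banach_fun_space_scale[OF X f])
    then have in_S: "T (\<lambda>z. of_real t * f z) \<in> S"
      using N_scale[OF f] t unfolding S_def by auto
    have "T f holomorphic_on ball 0 1" using T f X_HD unfolding intrinsic_def HD_def by blast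
    moreover have "\<forall>z\<in>ball 0 1. T (\<lambda>z. of_real t * f z) z = of_real t * T f z"
      using intrinsic_scale[OF T] f X_HD by blast
    ultimately have "t * Bv_norm v (T f) \<le> Bv_norm v (T (\<lambda>z. of_real t * f z))"
      using Bv_norm_scaleR_le[OF _ _ _ t(1)] in_S S by blast
    then show ?thesis using R(1)[OF in_S] by linarith
  qed
  have "Bv_norm v (T f) \<le> R * N f" if f: "f \<in> X" for f
  proof (cases "N f = 0")
    case False
    then have "0 < N f" using N_nonneg[OF f] by simp
    then show ?thesis using scaled[OF f, of "1 / N f"] by (simp add: field_simps)
  next
    case True
    \<comment> \<open>Then every multiple of \<open>f\<close> lies in the unit ball, so \<open>t * Bv_norm v (T f) \<le> R\<close> for all \<open>t > 0\<close>.\<close>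
    have "\<not> 0 < Bv_norm v (T f)"
    proof
      assume pos: "0 < Bv_norm v (T f)"
      have "0 < (R + 1) / Bv_norm v (T f)" using pos R(2) by simp
      then have "(R + 1) / Bv_norm v (T f) * Bv_norm v (T f) \<le> R"
        by (rule scaled[OF f]) (simp add: True)
      then show False using pos by simp
    qed
    then show ?thesis using True by simp
  qed
  then show ?thesis by blast
qed

theorem theorem3p3:
  fixes v :: "complex \<Rightarrow> real" and X :: "hfun set" and N :: "hfun \<Rightarrow> real"
    and T :: "hfun \<Rightarrow> hfun"
  assumes "typical_weight v"
    and "initial_space X N"
    and "\<forall>f\<in>X. \<forall>r::real. 0 \<le> r \<and> r < 1 \<longrightarrow> (\<lambda>z. f (of_real r * z)) \<in> X"
    and "\<exists>C. \<forall>f\<in>X. \<forall>r::real. 0 \<le> r \<and> r < 1 \<longrightarrow> N (\<lambda>z. f (of_real r * z)) \<le> C * N f"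
    and "intrinsic T"
    and "\<forall>f\<in>X. \<forall>r::real. 0 \<le> r \<and> r < 1 \<longrightarrow> T (\<lambda>z. f (of_real r * z)) \<in> Bv0 v"
    and "weakly_compact_op T X N v"
  shows "T ` X \<subseteq> Bv0 v \<and> (\<exists>C. \<forall>f\<in>X. Bv_norm v (T f) \<le> C * N f)"
proof
  have X: "banach_fun_space X N" using assms(2) unfolding initial_space_def by simp
  show "T ` X \<subseteq> Bv0 v" by (rule weakly_compact_op_image_Bv0[OF assms(1) X assms(3-7)])
  show "\<exists>C. \<forall>f\<in>X. Bv_norm v (T f) \<le> C * N f"
    by (rule weakly_compact_op_bounded[OF assms(1) X assms(5,7)])
qed

end
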